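(* Suppose the system $x_{t+1}=f(x_t,u_t,w_t)$, $y_t=h(x_t,u_t,w_t)$ admits a quadratically bounded (exponential) $\delta$-IOSS Lyapunov function $W_\delta$ with constants $\eta\in[0,1)$, $P_1,P_2\succ0$, $Q,R\succeq0$ (as defined in the context), and let $\hat x_t$ be the state estimates generated by the MHE scheme with horizon $M\in\mathbb{I}_{\ge0}$ described in the context, using these $\eta,P_2,Q,R$ in its cost. Then, for all $t\in\mathbb{I}_{\ge0}$, with $M_t=\min\{t,M\}$, $$W_\delta(\hat x_t,x_t)\le 2\eta^{M_t}\lambda_{\max}(P_2,P_1)\,W_\delta(\hat x_{t-M_t},x_{t-M_t})+V_{\mathrm{MHE}}(\hat x^*_{t-M_t|t},\hat w^*_{\cdot|t},\hat y^*_{\cdot|t},t)+2\sum_{j=1}^{M_t}\eta^{j-1}\|w_{t-j}\|_Q^2 .$$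
   Context: Notation: $\mathbb{I}_{\ge a}$ is the set of integers $\ge a$, $\mathbb{I}_{[a,b]}$ the integers in $[a,b]$. $\|x\|_Q^2=x^\top Qx$ for symmetric positive (semi)definite $Q$. For symmetric positive definite $A,B$, $\lambda_{\max}(A,B)$ is the maximum generalized eigenvalue, i.e. the largest $\lambda$ with $\det(A-\lambda B)=0$. Convention: $0^0=1$; empty sums are $0$. System: $x_{t+1}=f(x_t,u_t,w_t)$, $y_t=h(x_t,u_t,w_t)$, $t\in\mathbb{I}_{\ge0}$, with $f:\mathbb{R}^n\times\mathbb{R}^m\times\mathbb{R}^q\to\mathbb{R}^n$, $h:\mathbb{R}^n\times\mathbb{R}^m\times\mathbb{R}^q\to\mathbb{R}^p$ continuous. State $x_t$, known input $u_t$, unknown disturbance $w_t$, measured output $y_t$. The true trajectory satisfies $(x_t,u_t,w_t,y_t)\in\mathbb{Z}:=\mathbb{X}\times\mathbb{U}\times\mathbb{W}\times\mathbb{Y}$ for all $t\in\mathbb{I}_{\ge0}$, where $\mathbb{X}\subseteq\mathbb{R}^n$, $\mathbb{U}\subseteq\mathbb{R}^m$, $\mathbb{W}\subseteq\mathbb{R}^q$, $\mathbb{Y}\subseteq\mathbb{R}^p$. An initial guess $\hat x_0\in\mathbb{X}$ of $x_0$ is given. Quadratically bounded (exponential) $\delta$-IOSS Lyapunov function: a function $W_\delta:\mathbb{R}^n\times\mathbb{R}^n\to\mathbb{R}_{\ge0}$ for which there exist $\eta\in[0,1)$ and symmetric matrices $P_1,P_2\succ0$, $Q,R\succeq0$ such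 that both (a) $\|x-\tilde x\|_{P_1}^2\le W_\delta(x,\tilde x)\le\|x-\tilde x\|_{P_2}^2$ and (b) $W_\delta(f(x,u,w),f(\tilde x,u,\tilde w))\le\eta W_\delta(x,\tilde x)+\|w-\tilde w\|_Q^2+\|y-\tilde y\|_R^2$ hold for all $(x,u,w,y),(\tilde x,u,\tilde w,\tilde y)\in\mathbb{Z}$, where $y=h(x,u,w)$ and $\tilde y=h(\tilde x,u,\tilde w)$. MHE scheme: fix a horizon $M\in\mathbb{I}_{\ge0}$ and let $M_t=\min\{t,M\}$. At each time $t\in\mathbb{I}_{\ge0}$, given the past estimate $\hat x_{t-M_t}$ and data $u_j,y_j$, $j\in\mathbb{I}_{[t-M_t,t-1]}$, minimize over $\hat x_{t-M_t|t}$ and $\hat w_{\cdot|t}=\{\hat w_{j|t}\}_{j=t-M_t}^{t-1}$ the cost $$V_{\mathrm{MHE}}(\hat x_{t-M_t|t},\hat w_{\cdot|t},\hat y_{\cdot|t},t)=2\eta^{M_t}\|\hat x_{t-M_t|t}-\hat x_{t-M_t}\|_{P_2}^2+\sum_{j=1}^{M_t}\eta^{j-1}\left(2\|\hat w_{t-j|t}\|_Q^2+\|\hat y_{t-j|t}-y_{t-j}\|_R^2\right)$$ subject to $\hat x_{j+1|t}=f(\hat x_{j|t},u_j,\hat w_{j|t})$, $\hat y_{j|t}=h(\hat x_{j|t},u_j,\hat w_{j|t})$, $\hat w_{j|t}\in\mathbb{W}$, $\hat y_{j|t}\in\mathbb{Y}$ for $j\in\mathbb{I}_{[t-M_t,t-1]}$,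 and $\hat x_{j|t}\in\mathbb{X}$ for $j\in\mathbb{I}_{[t-M_t,t]}$. A minimizer is assumed to exist at each $t$; it and the corresponding trajectories are denoted by $\hat x^*_{\cdot|t},\hat w^*_{\cdot|t},\hat y^*_{\cdot|t}$. The estimate at time $t$ is $\hat x_t=\hat x^*_{t|t}$ (at $t=0$ this is the initial guess $\hat x_0$).
   Formalization: The quadratic bound (a) on W_δ is assumed for all x, x̃ in X, not only for states whose outputs h(x,u,w), h(x̃,u,w̃) lie in Y; under the literal restriction the claim fails, as estimates are only constrained to lie in X. *)

theory Defs
  imports "HOL-Analysis.Analysis"
begin

definition sym_pos_def :: "real^'n^'n \<Rightarrow> bool" where
  "sym_pos_def A \<longleftrightarrow> transpose A = A \<and> (\<forall>v. v \<noteq> 0 \<longrightarrow> 0 < v \<bullet> (A *v v))"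

definition sym_pos_semidef :: "real^'n^'n \<Rightarrow> bool" where
  "sym_pos_semidef A \<longleftrightarrow> transpose A = A \<and> (\<forall>v. 0 \<le> v \<bullet> (A *v v))"

text \<open>The squared weighted norm \<open>\<parallel>v\<parallel>\<^sub>Q\<^sup>2\<close>.\<close>

definition wnorm2 :: "real^'n^'n \<Rightarrow> real^'n \<Rightarrow> real" where
  "wnorm2 Q v = v \<bullet> (Q *v v)"

definition lambda_max :: "real^'n^'n \<Rightarrow> real^'n^'n \<Rightarrow> real" where
  "lambda_max A B = (GREATEST l. det (A - l *\<^sub>R B) = 0)"

text \<open>\<open>x\<close>, \<open>u\<close>, \<open>w\<close>, \<open>y\<close> are the state, input, disturbance and output sequences.\<close>

definition system_trajectory ::
  "((real^'n) \<times> (real^'m) \<times> (real^'q) \<Rightarrow> real^'n) \<Rightarrow>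
   ((real^'n) \<times> (real^'m) \<times> (real^'q) \<Rightarrow> real^'p) \<Rightarrow>
   (nat \<Rightarrow> real^'n) \<Rightarrow> (nat \<Rightarrow> real^'m) \<Rightarrow> (nat \<Rightarrow> real^'q) \<Rightarrow> (nat \<Rightarrow> real^'p) \<Rightarrow> bool" where
  "system_trajectory f h x u w y \<longleftrightarrow>
     (\<forall>t. x (Suc t) = f (x t, u t, w t) \<and> y t = h (x t, u t, w t))"

text \<open>
  Both inequalities range over pairs of points of \<open>X \<times> U \<times> W \<times> Y\<close> with a common input.
  The output equations are only imposed for the dissipation inequality, in which the outputs
  occur; so (if \<open>U\<close>, \<open>W\<close>, \<open>Y\<close> are nonempty) the quadratic bounds hold on all of \<open>X \<times> X\<close>,
  including states from which no admissible output is possible.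
\<close>

definition quad_exp_dIOSS_Lyapunov ::
  "((real^'n) \<times> (real^'m) \<times> (real^'q) \<Rightarrow> real^'n) \<Rightarrow>
   ((real^'n) \<times> (real^'m) \<times> (real^'q) \<Rightarrow> real^'p) \<Rightarrow>
   (real^'n) set \<Rightarrow> (real^'m) set \<Rightarrow> (real^'q) set \<Rightarrow> (real^'p) set \<Rightarrow>
   (real^'n \<Rightarrow> real^'n \<Rightarrow> real) \<Rightarrow> real \<Rightarrow>
   real^'n^'n \<Rightarrow> real^'n^'n \<Rightarrow> real^'q^'q \<Rightarrow> real^'p^'p \<Rightarrow> bool" where
  "quad_exp_dIOSS_Lyapunov f h X U W Y Wd \<eta> P1 P2 Q R \<longleftrightarrow>
     (\<forall>x x'. 0 \<le> Wd x x') \<and>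
     0 \<le> \<eta> \<and> \<eta> < 1 \<and>
     sym_pos_def P1 \<and> sym_pos_def P2 \<and> sym_pos_semidef Q \<and> sym_pos_semidef R \<and>
     (\<forall>x x' u w w' y y'.
        (x, u, w, y) \<in> X \<times> U \<times> W \<times> Y \<and> (x', u, w', y') \<in> X \<times> U \<times> W \<times> Y \<longrightarrow>
          wnorm2 P1 (x - x') \<le> Wd x x' \<and> Wd x x' \<le> wnorm2 P2 (x - x') \<and>
          (y = h (x, u, w) \<and> y' = h (x', u, w') \<longrightarrow>
             Wd (f (x, u, w)) (f (x', u, w'))
               \<le> \<eta> * Wd x x' + wnorm2 Q (w - w') + wnorm2 R (y - y')))"

text \<open>
  In the following, \<open>xe\<close> is the sequence of estimates and \<open>xh\<close>, \<open>wh\<close>, \<open>yh\<close> are candidate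
  trajectories of the optimization problem at time \<open>t\<close>, indexed by absolute time; only their
  values on the window from \<open>t - min t M\<close> to \<open>t\<close> are relevant.
\<close>

definition mhe_cost ::
  "real \<Rightarrow> real^'n^'n \<Rightarrow> real^'q^'q \<Rightarrow> real^'p^'p \<Rightarrow> nat \<Rightarrow>
   (nat \<Rightarrow> real^'n) \<Rightarrow> (nat \<Rightarrow> real^'p) \<Rightarrow>
   real^'n \<Rightarrow> (nat \<Rightarrow> real^'q) \<Rightarrow> (nat \<Rightarrow> real^'p) \<Rightarrow> nat \<Rightarrow> real" where
  "mhe_cost \<eta> P2 Q R M xe y z wh yh t =
     2 * \<eta> ^ min t M * wnorm2 P2 (z - xe (t - min t M)) +
     (\<Sum>j = 1..min t M. \<eta> ^ (j - 1) *
        (2 * wnorm2 Q (wh (t - j)) + wnorm2 R (yh (t - j) - y (t - j))))"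

definition mhe_feasible ::
  "((real^'n) \<times> (real^'m) \<times> (real^'q) \<Rightarrow> real^'n) \<Rightarrow>
   ((real^'n) \<times> (real^'m) \<times> (real^'q) \<Rightarrow> real^'p) \<Rightarrow>
   (real^'n) set \<Rightarrow> (real^'q) set \<Rightarrow> (real^'p) set \<Rightarrow> nat \<Rightarrow>
   (nat \<Rightarrow> real^'m) \<Rightarrow> nat \<Rightarrow>
   (nat \<Rightarrow> real^'n) \<Rightarrow> (nat \<Rightarrow> real^'q) \<Rightarrow> (nat \<Rightarrow> real^'p) \<Rightarrow> bool" where
  "mhe_feasible f h X W Y M u t xh wh yh \<longleftrightarrow>
     (\<forall>j \<in> {t - min t M..<t}.
        xh (Suc j) = f (xh j, u j, wh j) \<and> yh j = h (xh j, u j, wh j) \<and>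
        wh j \<in> W \<and> yh j \<in> Y) \<and>
     (\<forall>j \<in> {t - min t M..t}. xh j \<in> X)"

definition mhe_minimizer ::
  "((real^'n) \<times> (real^'m) \<times> (real^'q) \<Rightarrow> real^'n) \<Rightarrow>
   ((real^'n) \<times> (real^'m) \<times> (real^'q) \<Rightarrow> real^'p) \<Rightarrow>
   (real^'n) set \<Rightarrow> (real^'q) set \<Rightarrow> (real^'p) set \<Rightarrow>
   real \<Rightarrow> real^'n^'n \<Rightarrow> real^'q^'q \<Rightarrow> real^'p^'p \<Rightarrow> nat \<Rightarrow>
   (nat \<Rightarrow> real^'m) \<Rightarrow> (nat \<Rightarrow> real^'p) \<Rightarrow> (nat \<Rightarrow> real^'n) \<Rightarrow> nat \<Rightarrow>
   (nat \<Rightarrow> real^'n) \<Rightarrow> (nat \<Rightarrow> real^'q) \<Rightarrow> (nat \<Rightarrow> real^'p) \<Rightarrow> bool" where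
  "mhe_minimizer f h X W Y \<eta> P2 Q R M u y xe t xh wh yh \<longleftrightarrow>
     mhe_feasible f h X W Y M u t xh wh yh \<and>
     (\<forall>xh' wh' yh'. mhe_feasible f h X W Y M u t xh' wh' yh' \<longrightarrow>
        mhe_cost \<eta> P2 Q R M xe y (xh (t - min t M)) wh yh t
          \<le> mhe_cost \<eta> P2 Q R M xe y (xh' (t - min t M)) wh' yh' t)"

text \<open>
  \<open>xs t j\<close>, \<open>ws t j\<close>, \<open>ys t j\<close> are the optimal state, disturbance and output for time \<open>j\<close>
  computed at time \<open>t\<close>. The cost at time \<open>t\<close> refers to the estimate \<open>xe (t - min t M)\<close>;
  this is \<open>xe t\<close> itself if \<open>t = 0\<close> or \<open>M = 0\<close>, so the conditions below are stated as
  constraints on the whole sequence rather than as a recursion.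
\<close>

definition mhe_estimates ::
  "((real^'n) \<times> (real^'m) \<times> (real^'q) \<Rightarrow> real^'n) \<Rightarrow>
   ((real^'n) \<times> (real^'m) \<times> (real^'q) \<Rightarrow> real^'p) \<Rightarrow>
   (real^'n) set \<Rightarrow> (real^'q) set \<Rightarrow> (real^'p) set \<Rightarrow>
   real \<Rightarrow> real^'n^'n \<Rightarrow> real^'q^'q \<Rightarrow> real^'p^'p \<Rightarrow> nat \<Rightarrow>
   (nat \<Rightarrow> real^'m) \<Rightarrow> (nat \<Rightarrow> real^'p) \<Rightarrow> real^'n \<Rightarrow> (nat \<Rightarrow> real^'n) \<Rightarrow>
   (nat \<Rightarrow> nat \<Rightarrow> real^'n) \<Rightarrow> (nat \<Rightarrow> nat \<Rightarrow> real^'q) \<Rightarrow> (nat \<Rightarrow> nat \<Rightarrow> real^'p) \<Rightarrow> bool" where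
  "mhe_estimates f h X W Y \<eta> P2 Q R M u y x0_guess xe xs ws ys \<longleftrightarrow>
     xe 0 = x0_guess \<and>
     (\<forall>t. mhe_minimizer f h X W Y \<eta> P2 Q R M u y xe t (xs t) (ws t) (ys t) \<and> xe t = xs t t)"

end

theory Submission
  imports Defs
begin

text \<open>
  Iterating the dissipation inequality over the window bounds \<open>Wd (xe t) (x t)\<close> by the discounted
  initial value plus discounted disturbance and output differences. Splitting the disturbance
  differences and the initial error \<open>xs - x = (xs - xe) + (xe - x)\<close> by
  \<open>\<parallel>a + b\<parallel>\<^sup>2 \<le> 2\<parallel>a\<parallel>\<^sup>2 + 2\<parallel>b\<parallel>\<^sup>2\<close> yields the optimal cost, and the remaining term
  \<open>\<parallel>xe - x\<parallel>\<^sup>2\<close> in the norm of \<open>P2\<close> is compared with the norm of \<open>P1\<close>, and hence with \<open>Wd\<close>, by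
  maximizing the generalized Rayleigh quotient.
\<close>

lemma wnorm2_minus [simp]: "wnorm2 A (- v) = wnorm2 A v"
  unfolding wnorm2_def by (simp add: linear_neg[OF matrix_vector_mul_linear])

text \<open>Parallelogram identity: the cross terms of \<open>a + b\<close> and \<open>a - b\<close>
  cancel, and dropping the nonnegative \<open>wnorm2 A (a - b)\<close> leaves the bound.\<close>

lemma wnorm2_add_le:
  assumes "\<And>v. 0 \<le> wnorm2 A v"
  shows "wnorm2 A (a + b) \<le> 2 * wnorm2 A a + 2 * wnorm2 A b"
proof -
  have "wnorm2 A (a + b) + wnorm2 A (a - b) = 2 * wnorm2 A a + 2 * wnorm2 A b"
    unfolding wnorm2_def
    by (simp add: matrix_vector_right_distrib matrix_vector_mult_diff_distrib inner_simps)
  with assms[of "a - b"] show ?thesis by linarith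
qed

lemma wnorm2_diff_le:
  assumes "\<And>v. 0 \<le> wnorm2 A v"
  shows "wnorm2 A (a - b) \<le> 2 * wnorm2 A a + 2 * wnorm2 A b"
  using wnorm2_add_le[OF assms, of a "- b"] by simp

lemma sym_pos_def_nonneg: "sym_pos_def A \<Longrightarrow> 0 \<le> wnorm2 A v"
  unfolding sym_pos_def_def wnorm2_def by (cases "v = 0") (auto simp: less_imp_le)

lemma sym_pos_def_pos: "sym_pos_def A \<Longrightarrow> v \<noteq> 0 \<Longrightarrow> 0 < wnorm2 A v"
  unfolding sym_pos_def_def wnorm2_def by auto

lemma wnorm2_scaleR: "wnorm2 A (c *\<^sub>R v) = c\<^sup>2 * wnorm2 A v"
  unfolding wnorm2_def
  by (simp add: linear_scale[OF matrix_vector_mul_linear] power2_eq_square)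

lemma wnorm2_diff_matrix: "wnorm2 (A - B) v = wnorm2 A v - wnorm2 B v"
  unfolding wnorm2_def by (simp add: matrix_vector_mult_diff_rdistrib inner_simps)

lemma wnorm2_scaleR_matrix: "wnorm2 (c *\<^sub>R A) v = c * wnorm2 A v"
  unfolding wnorm2_def by (simp add: scaleR_matrix_vector_assoc[symmetric])

lemma continuous_on_wnorm2: "continuous_on S (wnorm2 A)"
  unfolding wnorm2_def
  by (intro continuous_intros linear_continuous_on matrix_vector_mul_bounded_linear)

text \<open>A nonnegative form is minimal where it vanishes, so its gradient
  \<open>2 * (A *v v)\<close> is zero there. Otherwise a step from \<open>v\<close> against
  \<open>A *v v\<close> would make the form negative.\<close>

lemma sym_pos_semidef_kernel:
  assumes A: "sym_pos_semidef A" and v: "wnorm2 A v = 0"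
  shows "A *v v = 0"
proof (rule ccontr)
  define e where "e = A *v v"
  define c where "c = wnorm2 A e"
  \<comment> \<open>The form at \<open>v - s *\<^sub>R e\<close> is a quadratic in \<open>s\<close>
    with minimizer \<open>(e \<bullet> e) / c\<close>. The denominator \<open>c + 1\<close> also
    covers \<open>c = 0\<close> and still gives \<open>s * c \<le> e \<bullet> e\<close>.\<close>
  define s where "s = (e \<bullet> e) / (c + 1)"
  assume "A *v v \<noteq> 0"
  then have pos: "0 < e \<bullet> e" by (simp add: e_def)
  have nonneg: "0 \<le> wnorm2 A z" for z
    using A by (simp add: sym_pos_semidef_def wnorm2_def)
  have c: "0 \<le> c" by (simp add: c_def nonneg)
  have sym: "v \<bullet> (A *v e) = e \<bullet> e"
    using A by (metis dot_lmul_matrix e_def sym_pos_semidef_def transpose_matrix_vector)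
  have "wnorm2 A (v - s *\<^sub>R e) = s\<^sup>2 * c - 2 * s * (e \<bullet> e)"
    using v sym unfolding wnorm2_def c_def
    by (simp add: matrix_vector_mult_diff_distrib matrix_vector_mult_scaleR inner_simps
        e_def[symmetric] power2_eq_square algebra_simps)
  also have "\<dots> = s * (s * c - 2 * (e \<bullet> e))"
    by (simp add: power2_eq_square algebra_simps)
  also have "\<dots> < 0"
  proof (rule mult_pos_neg)
    show "0 < s" using pos c by (simp add: s_def)
    have "s * c \<le> s * (c + 1)" using \<open>0 < s\<close> by simp
    also have "\<dots> = e \<bullet> e" using c by (simp add: s_def)
    finally show "s * c - 2 * (e \<bullet> e) < 0" using pos by linarith
  qed
  finally show False using nonneg[of "v - s *\<^sub>R e"] by simp
qed

text \<open>The quotient \<open>r\<close> attains a maximum \<open>l\<close> on the compact unit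
  sphere. Once \<open>l\<close> is shown to be the largest root of the determinant,
  \<open>GREATEST\<close> in \<open>lambda_max\<close> denotes it, and the bound is the maximality
  of \<open>l\<close>.\<close>

lemma
  fixes A B :: "real^'n^'n"
  assumes A: "sym_pos_def A" and B: "sym_pos_def B"
  shows lambda_max_pos: "0 < lambda_max A B"
    and wnorm2_le_lambda_max: "wnorm2 A v \<le> lambda_max A B * wnorm2 B v"
proof -
  let ?S = "sphere (0 :: real^'n) 1"
  define r where "r v = wnorm2 A v / wnorm2 B v" for v
  have Bpos: "0 < wnorm2 B v" if "v \<noteq> 0" for v
    using that B by (rule sym_pos_def_pos[rotated])
  have "\<forall>v \<in> ?S. wnorm2 B v \<noteq> 0" by (metis Bpos less_irrefl mem_sphere_0 norm_zero zero_neq_one)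
  then have "continuous_on ?S r"
    unfolding r_def by (intro continuous_on_divide continuous_on_wnorm2)
  moreover have "?S \<noteq> {}" by simp
  ultimately obtain v0 where v0: "v0 \<in> ?S" and max: "\<And>v. v \<in> ?S \<Longrightarrow> r v \<le> r v0"
    using continuous_attains_sup[OF compact_sphere] by metis
  have nz: "v0 \<noteq> 0" using v0 by auto
  define l where "l = r v0"
  have l_pos: "0 < l"
    unfolding l_def r_def using Bpos[OF nz] sym_pos_def_pos[OF A nz] by simp
  have bound: "wnorm2 A v \<le> l * wnorm2 B v" for v
  proof (cases "v = 0")
    case True
    then show ?thesis by (simp add: wnorm2_def)
  next
    case False
    have "r (v /\<^sub>R norm v) \<le> l" unfolding l_def using False by (intro max) simp
    \<comment> \<open>Scale invariance of \<open>r\<close> carries the bound from the sphere to all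
      nonzero vectors.\<close>
    moreover have "r (v /\<^sub>R norm v) = r v" using False by (simp add: r_def wnorm2_scaleR)
    ultimately have "r v \<le> l" by simp
    then show ?thesis using Bpos[OF False] by (simp add: r_def divide_le_eq)
  qed
  let ?C = "l *\<^sub>R B - A"
  have C: "wnorm2 ?C v = l * wnorm2 B v - wnorm2 A v" for v
    by (simp add: wnorm2_diff_matrix wnorm2_scaleR_matrix)
  \<comment> \<open>\<open>l\<close> is a root: the semidefinite form of \<open>?C\<close> vanishes
    at the maximizer \<open>v0\<close>, so \<open>v0\<close> lies in the kernel and
    \<open>?C\<close> is singular.\<close>
  have "transpose ?C = ?C"
    using A B unfolding sym_pos_def_def by (simp add: transpose_def vec_eq_iff)
  then have "sym_pos_semidef ?C"
    unfolding sym_pos_semidef_def wnorm2_def[symmetric] using bound C by simp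
  moreover have "wnorm2 ?C v0 = 0"
    unfolding C using Bpos[OF nz] by (simp add: l_def r_def)
  ultimately have "?C *v v0 = 0" by (rule sym_pos_semidef_kernel)
  then have "(A - l *\<^sub>R B) *v v0 = 0" by (simp add: matrix_vector_mult_diff_rdistrib)
  then have det: "det (A - l *\<^sub>R B) = 0"
    using nz by (metis invertible_det_nz matrix_left_invertible_ker invertible_left_inverse)
  \<comment> \<open>Any root \<open>l'\<close> is the value of \<open>r\<close> at a generalized
    eigenvector, hence at most the maximum.\<close>
  have "l' \<le> l" if "det (A - l' *\<^sub>R B) = 0" for l'
  proof -
    obtain v where v: "v \<noteq> 0" "(A - l' *\<^sub>R B) *v v = 0"
      using \<open>det (A - l' *\<^sub>R B) = 0\<close>
      by (metis invertible_det_nz matrix_left_invertible_ker invertible_left_inverse)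
    then have "wnorm2 (A - l' *\<^sub>R B) v = 0" by (simp add: wnorm2_def)
    then have "l' * wnorm2 B v \<le> l * wnorm2 B v"
      using bound[of v] by (simp add: wnorm2_diff_matrix wnorm2_scaleR_matrix)
    then show "l' \<le> l" using Bpos[OF v(1)] by simp
  qed
  with det have "lambda_max A B = l" unfolding lambda_max_def by (intro Greatest_equality)
  with l_pos bound show "0 < lambda_max A B" "wnorm2 A v \<le> lambda_max A B * wnorm2 B v"
    by auto
qed

text \<open>Induction on the window length with the end \<open>t\<close> fixed: the window grows
  into the past, so the newly added oldest term \<open>c (t - Suc k)\<close> receives the weight
  \<open>\<eta> ^ k\<close>.\<close>

lemma discounted_recursion_le:
  fixes a c :: "nat \<Rightarrow> real"
  assumes "0 \<le> \<eta>" and "k \<le> t"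
    and step: "\<And>j. t - k \<le> j \<Longrightarrow> j < t \<Longrightarrow> a (Suc j) \<le> \<eta> * a j + c j"
  shows "a t \<le> \<eta> ^ k * a (t - k) + (\<Sum>j = 1..k. \<eta> ^ (j - 1) * c (t - j))"
  using assms(2) step
proof (induction k)
  case 0
  then show ?case by simp
next
  case (Suc k)
  have "a (t - k) \<le> \<eta> * a (t - Suc k) + c (t - Suc k)"
    using Suc.prems(2)[of "t - Suc k"] Suc.prems(1) by (simp add: Suc_diff_Suc)
  then have "\<eta> ^ k * a (t - k) \<le> \<eta> ^ k * (\<eta> * a (t - Suc k) + c (t - Suc k))"
    using \<open>0 \<le> \<eta>\<close> by (intro mult_left_mono) auto
  moreover have "a t \<le> \<eta> ^ k * a (t - k) + (\<Sum>j = 1..k. \<eta> ^ (j - 1) * c (t - j))"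
    using Suc.prems by (intro Suc.IH) auto
  ultimately show ?case by (simp add: algebra_simps)
qed

theorem proposition1:
  fixes f :: "(real^'n) \<times> (real^'m) \<times> (real^'q) \<Rightarrow> real^'n"
    and h :: "(real^'n) \<times> (real^'m) \<times> (real^'q) \<Rightarrow> real^'p"
    and X :: "(real^'n) set" and U :: "(real^'m) set"
    and W :: "(real^'q) set" and Y :: "(real^'p) set"
    and Wd :: "real^'n \<Rightarrow> real^'n \<Rightarrow> real"
    and \<eta> :: real
    and P1 P2 :: "real^'n^'n" and Q :: "real^'q^'q" and R :: "real^'p^'p"
    and x :: "nat \<Rightarrow> real^'n" and u :: "nat \<Rightarrow> real^'m"
    and w :: "nat \<Rightarrow> real^'q" and y :: "nat \<Rightarrow> real^'p"
    and M :: nat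
    and x0_guess :: "real^'n" and xe :: "nat \<Rightarrow> real^'n"
    and xs :: "nat \<Rightarrow> nat \<Rightarrow> real^'n"
    and ws :: "nat \<Rightarrow> nat \<Rightarrow> real^'q"
    and ys :: "nat \<Rightarrow> nat \<Rightarrow> real^'p"
    and t :: nat
  assumes "continuous_on UNIV f" and "continuous_on UNIV h"
    and "system_trajectory f h x u w y"
    and "\<And>s. (x s, u s, w s, y s) \<in> X \<times> U \<times> W \<times> Y"
    and "quad_exp_dIOSS_Lyapunov f h X U W Y Wd \<eta> P1 P2 Q R"
    and "x0_guess \<in> X"
    and "mhe_estimates f h X W Y \<eta> P2 Q R M u y x0_guess xe xs ws ys"
  shows "Wd (xe t) (x t)
      \<le> 2 * \<eta> ^ min t M * lambda_max P2 P1 * Wd (xe (t - min t M)) (x (t - min t M))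
        + mhe_cost \<eta> P2 Q R M xe y (xs t (t - min t M)) (ws t) (ys t) t
        + 2 * (\<Sum>j = 1..min t M. \<eta> ^ (j - 1) * wnorm2 Q (w (t - j)))"
proof -
  define k where "k = min t M"
  define s where "s = t - k"
  have kt: "k \<le> t" by (simp add: k_def)
  note L = assms(5)[unfolded quad_exp_dIOSS_Lyapunov_def]
  have \<eta>: "0 \<le> \<eta>" and P1: "sym_pos_def P1" and P2: "sym_pos_def P2"
    and Q: "sym_pos_semidef Q"
    using L by blast+
  have Q_nonneg: "0 \<le> wnorm2 Q v" for v
    using Q by (simp add: sym_pos_semidef_def wnorm2_def)
  have dyn: "x (Suc j) = f (x j, u j, w j)" "y j = h (x j, u j, w j)" for j
    using assms(3) by (auto simp: system_trajectory_def)
  have in_Z: "x j \<in> X" "u j \<in> U" "w j \<in> W" "y j \<in> Y" for j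
    using assms(4)[of j] by auto
  \<comment> \<open>The true \<open>u j\<close>, \<open>w j\<close>, \<open>y j\<close> complete
    both \<open>a\<close> and \<open>x j\<close> to admissible points with a common input, so
    membership of \<open>a\<close> in \<open>X\<close> suffices.\<close>
  have bounds: "wnorm2 P1 (a - x j) \<le> Wd a (x j)" "Wd a (x j) \<le> wnorm2 P2 (a - x j)"
    if "a \<in> X" for a j
    using L that in_Z by blast+
  have feas: "mhe_feasible f h X W Y M u t' (xs t') (ws t') (ys t')" and xe: "xe t' = xs t' t'" for t'
    using assms(7) by (auto simp: mhe_estimates_def mhe_minimizer_def)
  \<comment> \<open>The state constraint includes the right end of the window, which is where the
    estimate is read off.\<close>
  have xe_X: "xe j \<in> X" for j
    using feas[of j] by (simp add: xe mhe_feasible_def)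
  have xs_X: "xs t s \<in> X"
    using feas[of t] by (auto simp: s_def k_def mhe_feasible_def)
  let ?l = "lambda_max P2 P1"
  \<comment> \<open>On the window the optimal and the true trajectory are driven by the same inputs,
    so the dissipation inequality applies to the pair.\<close>
  have "Wd (xs t (Suc j)) (x (Suc j)) \<le> \<eta> * Wd (xs t j) (x j)
      + (wnorm2 Q (ws t j - w j) + wnorm2 R (ys t j - y j))"
    if "t - k \<le> j" "j < t" for j
  proof -
    have "j \<in> {t - min t M..<t}" "j \<in> {t - min t M..t}" using that by (auto simp: k_def)
    then have "xs t (Suc j) = f (xs t j, u j, ws t j)" "ys t j = h (xs t j, u j, ws t j)"
      "ws t j \<in> W" "ys t j \<in> Y" "xs t j \<in> X"
      using feas[of t] unfolding mhe_feasible_def by blast+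
    with L in_Z[of j] dyn[of j] show ?thesis by (simp add: add.assoc)
  qed
  from discounted_recursion_le[where a = "\<lambda>j. Wd (xs t j) (x j)", OF \<eta> kt this]
  have "Wd (xe t) (x t) \<le> \<eta> ^ k * Wd (xs t s) (x s)
      + (\<Sum>j = 1..k. \<eta> ^ (j - 1)
          * (wnorm2 Q (ws t (t - j) - w (t - j)) + wnorm2 R (ys t (t - j) - y (t - j))))"
    by (simp add: xe s_def)
  also have "\<dots> \<le> \<eta> ^ k * (2 * wnorm2 P2 (xs t s - xe s) + 2 * (?l * Wd (xe s) (x s)))
      + (\<Sum>j = 1..k. \<eta> ^ (j - 1)
          * (2 * wnorm2 Q (ws t (t - j)) + 2 * wnorm2 Q (w (t - j))
             + wnorm2 R (ys t (t - j) - y (t - j))))"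
  proof (intro add_mono sum_mono mult_left_mono wnorm2_diff_le Q_nonneg order_refl)
    have "Wd (xs t s) (x s) \<le> wnorm2 P2 ((xs t s - xe s) + (xe s - x s))"
      using bounds(2)[OF xs_X] by simp
    also have "\<dots> \<le> 2 * wnorm2 P2 (xs t s - xe s) + 2 * wnorm2 P2 (xe s - x s)"
      by (intro wnorm2_add_le sym_pos_def_nonneg P2)
    also have "wnorm2 P2 (xe s - x s) \<le> ?l * wnorm2 P1 (xe s - x s)"
      by (rule wnorm2_le_lambda_max[OF P2 P1])
    \<comment> \<open>Positivity of \<open>?l\<close> lets the lower bound on \<open>Wd\<close> be
      multiplied through.\<close>
    also have "\<dots> \<le> ?l * Wd (xe s) (x s)"
      using lambda_max_pos[OF P2 P1] bounds(1)[OF xe_X] by (intro mult_left_mono) auto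
    finally show "Wd (xs t s) (x s)
        \<le> 2 * wnorm2 P2 (xs t s - xe s) + 2 * (?l * Wd (xe s) (x s))"
      by simp
  qed (use \<eta> in auto)
  \<comment> \<open>The factors 2 from the two splittings are the weights 2 in the cost; the output
    differences stay unsplit and keep weight 1.\<close>
  also have "\<dots> = 2 * \<eta> ^ k * ?l * Wd (xe s) (x s)
      + mhe_cost \<eta> P2 Q R M xe y (xs t s) (ws t) (ys t) t
      + 2 * (\<Sum>j = 1..k. \<eta> ^ (j - 1) * wnorm2 Q (w (t - j)))"
    by (simp add: mhe_cost_def k_def[symmetric] s_def[symmetric] algebra_simps sum.distrib
        sum_distrib_left)
  finally show ?thesis by (simp add: k_def s_def)
qed

end
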